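(* The supercommutator Hom-superalgebra of any multiplicative right Hom-alternative superalgebra is a Hom-Bol superalgebra.
   Context: All vector spaces are over a fixed field of characteristic not $2$ or $3$. A superspace is a $\mathbb Z_2$-graded vector space $A=A_0\oplus A_1$; $\bar x$ is the degree of a homogeneous $x$. A linear map is even if it preserves degrees. A multiplicative Hom-superalgebra $(A,*,\alpha)$ is a superspace with a bilinear product satisfying $A_i*A_j\subseteq A_{i+j}$ and an even linear map $\alpha:A\to A$ with $\alpha(x*y)=\alpha(x)*\alpha(y)$. It is right Hom-alternative if $as(x,y,z)=-(-1)^{\bar y\bar z}as(x,z,y)$ for all homogeneous $x,y,z$, where $as(x,y,z)=(x*y)*\alpha(z)-\alpha(x)*(y*z)$. The supercommutator Hom-superalgebra of $(A,*,\alpha)$ is $(A,[\cdot,\cdot],\alpha)$, where $[x,y]:=\tfrac12\big(x*y-(-1)^{\bar x\bar y}y*x\big)$ for homogeneous $x,y$. Saying that it is a Hom-Bol superalgebra means that $A$ carries a ternary operation $\{\cdot,\cdot,\cdot\}$ for which $(A,[\cdot,\cdot],\{\cdot,\cdot,\cdot\},\alpha)$ is a Hom-Bol superalgebra in the following sense. A Hom-Bol superalgebra is a quadruple $(A,[\cdot,\cdot],\{\cdot,\cdot,\cdot\},\alpha)$ with $A$ a superspace, $[\cdot,\cdot]$ bilinear, $\{\cdot,\cdot,\cdot\}$ trilinear, $\alpha:A\to A$ even linear, $[A_i,A_j]\subseteq A_{i+j}$, $\{A_i,A_j,A_k\}\subseteq A_{i+j+k}$, and for all homogeneous $u,v,w,x,y,z$: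 (SHB01) $\alpha([x,y])=[\alpha(x),\alpha(y)]$; (SHB02) $\alpha(\{x,y,z\})=\{\alpha(x),\alpha(y),\alpha(z)\}$; (SHB1) $[x,y]=-(-1)^{\bar x\bar y}[y,x]$; (SHB2) $\{x,y,z\}=-(-1)^{\bar x\bar y}\{y,x,z\}$; (SHB3) $\{x,y,z\}+(-1)^{\bar x(\bar y+\bar z)}\{y,z,x\}+(-1)^{\bar z(\bar x+\bar y)}\{z,x,y\}=0$; (SHB4) $\{\alpha(x),\alpha(y),[u,v]\}=[\{x,y,u\},\alpha^2(v)]+(-1)^{\bar u(\bar x+\bar y)}[\alpha^2(u),\{x,y,v\}]+(-1)^{(\bar x+\bar y)(\bar u+\bar v)}\big(\{\alpha(u),\alpha(v),[x,y]\}-[[\alpha(u),\alpha(v)],[\alpha(x),\alpha(y)]]\big)$; (SHB5) $\{\alpha^2(x),\alpha^2(y),\{u,v,w\}\}=\{\{x,y,u\},\alpha^2(v),\alpha^2(w)\}+(-1)^{\bar u(\bar x+\bar y)}\{\alpha^2(u),\{x,y,v\},\alpha^2(w)\}+(-1)^{(\bar x+\bar y)(\bar u+\bar v)}\{\alpha^2(u),\alpha^2(v),\{x,y,w\}\}$. *)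

theory Defs
  imports "HOL-Library.Z2" "HOL-Computational_Algebra.Computational_Algebra"
begin

text \<open>
  The grading group is the type \<open>bit\<close> of integers mod 2. A statement about homogeneous elements
  takes the degrees \<open>i\<close>, \<open>j\<close>, ... as variables, with hypotheses \<open>x \<in> V i\<close>, \<open>y \<in> V j\<close>, ....
  The zero vector belongs to both components.
\<close>

definition ksign :: "bit \<Rightarrow> 'k::ring_1" where
  "ksign i = (-1) ^ (of_bit i :: nat)"

lemma ksign_simps [simp]: "ksign 0 = 1" "ksign 1 = -1"
  by (simp_all add: ksign_def)

locale superspace = vector_space scale
  for scale :: "'k::field \<Rightarrow> 'a::ab_group_add \<Rightarrow> 'a"  (infixr \<open>*s\<close> 75) +
  fixes V :: "bit \<Rightarrow> 'a set"
  assumes subspace_component: "subspace (V i)"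
    and component_inter: "V 0 \<inter> V 1 = {0}"
    and component_sum: "\<exists>y\<in>V 0. \<exists>z\<in>V 1. x = y + z"

locale even_linear_map = superspace scale V + Vector_Spaces.linear scale scale \<alpha>
  for scale :: "'k::field \<Rightarrow> 'a::ab_group_add \<Rightarrow> 'a"  (infixr \<open>*s\<close> 75)
    and V :: "bit \<Rightarrow> 'a set" and \<alpha> :: "'a \<Rightarrow> 'a" +
  assumes even: "x \<in> V i \<Longrightarrow> \<alpha> x \<in> V i"

definition bilinear_op :: "('k::field \<Rightarrow> 'a::ab_group_add \<Rightarrow> 'a) \<Rightarrow> ('a \<Rightarrow> 'a \<Rightarrow> 'a) \<Rightarrow> bool" where
  "bilinear_op scale f \<longleftrightarrow>
     (\<forall>y. Vector_Spaces.linear scale scale (\<lambda>x. f x y)) \<and>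
     (\<forall>x. Vector_Spaces.linear scale scale (\<lambda>y. f x y))"

definition trilinear_op :: "('k::field \<Rightarrow> 'a::ab_group_add \<Rightarrow> 'a) \<Rightarrow> ('a \<Rightarrow> 'a \<Rightarrow> 'a \<Rightarrow> 'a) \<Rightarrow> bool" where
  "trilinear_op scale f \<longleftrightarrow>
     (\<forall>y z. Vector_Spaces.linear scale scale (\<lambda>x. f x y z)) \<and>
     (\<forall>x z. Vector_Spaces.linear scale scale (\<lambda>y. f x y z)) \<and>
     (\<forall>x y. Vector_Spaces.linear scale scale (\<lambda>z. f x y z))"

locale multiplicative_hom_superalgebra = even_linear_map scale V \<alpha>
  for scale :: "'k::field \<Rightarrow> 'a::ab_group_add \<Rightarrow> 'a"  (infixr \<open>*s\<close> 75)
    and V :: "bit \<Rightarrow> 'a set"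
    and mul :: "'a \<Rightarrow> 'a \<Rightarrow> 'a"  (infixl \<open>\<star>\<close> 70)
    and \<alpha> :: "'a \<Rightarrow> 'a" +
  assumes bilinear: "bilinear_op scale (\<star>)"
    and graded: "x \<in> V i \<Longrightarrow> y \<in> V j \<Longrightarrow> x \<star> y \<in> V (i + j)"
    and multiplicative: "\<alpha> (x \<star> y) = \<alpha> x \<star> \<alpha> y"

definition hom_associator :: "('a \<Rightarrow> 'a \<Rightarrow> 'a) \<Rightarrow> ('a \<Rightarrow> 'a) \<Rightarrow> 'a \<Rightarrow> 'a \<Rightarrow> 'a \<Rightarrow> 'a::ab_group_add" where
  "hom_associator mul \<alpha> x y z = mul (mul x y) (\<alpha> z) - mul (\<alpha> x) (mul y z)"

locale right_hom_alternative_superalgebra = multiplicative_hom_superalgebra scale V mul \<alpha>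
  for scale :: "'k::field \<Rightarrow> 'a::ab_group_add \<Rightarrow> 'a"  (infixr \<open>*s\<close> 75)
    and V :: "bit \<Rightarrow> 'a set"
    and mul :: "'a \<Rightarrow> 'a \<Rightarrow> 'a"  (infixl \<open>\<star>\<close> 70)
    and \<alpha> :: "'a \<Rightarrow> 'a" +
  assumes right_alternative:
    "x \<in> V i \<Longrightarrow> y \<in> V j \<Longrightarrow> z \<in> V k \<Longrightarrow>
       hom_associator (\<star>) \<alpha> x y z = - (ksign (j * k) *s hom_associator (\<star>) \<alpha> x z y)"

text \<open>Component of degree \<open>i\<close> of a vector; in \<open>bit\<close>, \<open>i + 1\<close> is the other degree.\<close>

definition hcomp :: "(bit \<Rightarrow> 'a set) \<Rightarrow> bit \<Rightarrow> 'a \<Rightarrow> 'a::ab_group_add" where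
  "hcomp V i x = (THE y. y \<in> V i \<and> (\<exists>z\<in>V (i + 1). x = y + z))"

text \<open>
  The supercommutator is given by a formula on homogeneous elements only; this is its bilinear
  extension. The lemma \<open>supercommutator_homogeneous\<close> below recovers the formula.
\<close>

definition supercommutator ::
  "('k::field \<Rightarrow> 'a::ab_group_add \<Rightarrow> 'a) \<Rightarrow> (bit \<Rightarrow> 'a set) \<Rightarrow> ('a \<Rightarrow> 'a \<Rightarrow> 'a) \<Rightarrow> 'a \<Rightarrow> 'a \<Rightarrow> 'a" where
  "supercommutator scale V mul x y =
     (\<Sum>i\<in>{0, 1}. \<Sum>j\<in>{0, 1}.
        scale (1 / 2) (mul (hcomp V i x) (hcomp V j y)
                       - scale (ksign (i * j)) (mul (hcomp V j y) (hcomp V i x))))"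

locale hom_bol_superalgebra = even_linear_map scale V \<alpha>
  for scale :: "'k::field \<Rightarrow> 'a::ab_group_add \<Rightarrow> 'a"  (infixr \<open>*s\<close> 75)
    and V :: "bit \<Rightarrow> 'a set"
    and br :: "'a \<Rightarrow> 'a \<Rightarrow> 'a"
    and tri :: "'a \<Rightarrow> 'a \<Rightarrow> 'a \<Rightarrow> 'a"
    and \<alpha> :: "'a \<Rightarrow> 'a" +
  assumes bilinear: "bilinear_op scale br"
    and trilinear: "trilinear_op scale tri"
    and br_graded: "x \<in> V i \<Longrightarrow> y \<in> V j \<Longrightarrow> br x y \<in> V (i + j)"
    and tri_graded: "x \<in> V i \<Longrightarrow> y \<in> V j \<Longrightarrow> z \<in> V k \<Longrightarrow> tri x y z \<in> V (i + j + k)"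
    and SHB01: "x \<in> V i \<Longrightarrow> y \<in> V j \<Longrightarrow> \<alpha> (br x y) = br (\<alpha> x) (\<alpha> y)"
    and SHB02: "x \<in> V i \<Longrightarrow> y \<in> V j \<Longrightarrow> z \<in> V k \<Longrightarrow>
      \<alpha> (tri x y z) = tri (\<alpha> x) (\<alpha> y) (\<alpha> z)"
    and SHB1: "x \<in> V i \<Longrightarrow> y \<in> V j \<Longrightarrow> br x y = - (ksign (i * j) *s br y x)"
    and SHB2: "x \<in> V i \<Longrightarrow> y \<in> V j \<Longrightarrow> z \<in> V k \<Longrightarrow>
      tri x y z = - (ksign (i * j) *s tri y x z)"
    and SHB3: "x \<in> V i \<Longrightarrow> y \<in> V j \<Longrightarrow> z \<in> V k \<Longrightarrow>
      tri x y z + ksign (i * (j + k)) *s tri y z x + ksign (k * (i + j)) *s tri z x y = 0"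
    and SHB4: "x \<in> V i \<Longrightarrow> y \<in> V j \<Longrightarrow> u \<in> V k \<Longrightarrow> v \<in> V l \<Longrightarrow>
      tri (\<alpha> x) (\<alpha> y) (br u v) =
        br (tri x y u) ((\<alpha> ^^ 2) v)
        + ksign (k * (i + j)) *s br ((\<alpha> ^^ 2) u) (tri x y v)
        + ksign ((i + j) * (k + l)) *s
            (tri (\<alpha> u) (\<alpha> v) (br x y) - br (br (\<alpha> u) (\<alpha> v)) (br (\<alpha> x) (\<alpha> y)))"
    and SHB5: "x \<in> V i \<Longrightarrow> y \<in> V j \<Longrightarrow> u \<in> V k \<Longrightarrow> v \<in> V l \<Longrightarrow> w \<in> V m \<Longrightarrow>
      tri ((\<alpha> ^^ 2) x) ((\<alpha> ^^ 2) y) (tri u v w) =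
        tri (tri x y u) ((\<alpha> ^^ 2) v) ((\<alpha> ^^ 2) w)
        + ksign (k * (i + j)) *s tri ((\<alpha> ^^ 2) u) (tri x y v) ((\<alpha> ^^ 2) w)
        + ksign ((i + j) * (k + l)) *s tri ((\<alpha> ^^ 2) u) ((\<alpha> ^^ 2) v) (tri x y w)"

context superspace
begin

lemma hcomp_eqI:
  assumes y: "y \<in> V i" and z: "z \<in> V (i + 1)"
  shows "hcomp V i (y + z) = y"
  unfolding hcomp_def
proof (rule the_equality)
  show "y \<in> V i \<and> (\<exists>z'\<in>V (i + 1). y + z = y + z')" using y z by blast
next
  fix y' assume "y' \<in> V i \<and> (\<exists>z'\<in>V (i + 1). y + z = y' + z')"
  then obtain z' where y': "y' \<in> V i" and z': "z' \<in> V (i + 1)" and eq: "y + z = y' + z'"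
    by blast
  have "y' - y = z - z'" using eq by (simp add: algebra_simps)
  moreover have "y' - y \<in> V i" "z - z' \<in> V (i + 1)"
    using y y' z z' subspace_diff subspace_component by blast+
  ultimately have "y' - y \<in> V 0 \<inter> V 1" by (cases i) auto
  then show "y' = y" using component_inter by simp
qed

lemma hcomp_homogeneous:
  assumes "x \<in> V i"
  shows "hcomp V j x = (if j = i then x else 0)"
proof -
  have zero: "0 \<in> V k" for k using subspace_0 subspace_component by blast
  have "x \<in> V (i + 1 + 1)" using assms by (cases i) simp_all
  then have "hcomp V (i + 1) (0 + x) = 0" by (rule hcomp_eqI[OF zero])
  moreover have "hcomp V i (x + 0) = x" using assms zero by (rule hcomp_eqI)
  ultimately show ?thesis by (cases i; cases j) auto
qed

end

lemma (in multiplicative_hom_superalgebra) supercommutator_homogeneous: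
  assumes "x \<in> V i" "y \<in> V j"
  shows "supercommutator scale V (\<star>) x y = (1 / 2) *s (x \<star> y - ksign (i * j) *s (y \<star> x))"
proof -
  have l: "Vector_Spaces.linear scale scale (\<lambda>x. x \<star> y)"
    and r: "Vector_Spaces.linear scale scale (\<lambda>y. x \<star> y)" for x y
    using bilinear by (auto simp: bilinear_op_def)
  have "0 \<star> y = 0" "y \<star> 0 = 0" for y
    using module_hom.zero[OF Vector_Spaces.linear.axioms(3)[OF l[of y]]]
      module_hom.zero[OF Vector_Spaces.linear.axioms(3)[OF r[of y]]] by auto
  then show ?thesis
    using assms by (cases i; cases j) (simp_all add: supercommutator_def hcomp_homogeneous)
qed

end

(* Right alternativity says that right multiplication, twisted by \<alpha>, sends the Jordan
   superproduct to the Jordan superproduct of operators. Since the double commutator of operators is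
   the associator x(yz) - y(xz) of that product, [[R_x, R_y], R_z] is the right multiplication
   by {x,y,z} = [x,y]z - [R_x, R_y](z). Writing T = {x,y,_} and D = [R_x, R_y], this reads
   D(tz) = D(t) z - t T(z). Both (SHB4) and (SHB5) are linear consequences of this one rule. The
   triple product of the Hom-Bol structure is a quarter of {x,y,z} because of the factor 1/2 in the
   supercommutator. *)
theory Submission
  imports Defs
begin

section \<open>Linearity of the projections onto homogeneous components\<close>

context superspace
begin

lemma linearI:
  assumes "\<And>x y. f (x + y) = f x + f y" "\<And>c x. f (c *s x) = c *s f x"
  shows "Vector_Spaces.linear scale scale f"
  by unfold_locales (use assms in \<open>auto simp: scale_right_distrib scale_left_distrib\<close>)

lemma subspace_simps:
  "x \<in> V i \<Longrightarrow> y \<in> V i \<Longrightarrow> x + y \<in> V i"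
  "x \<in> V i \<Longrightarrow> y \<in> V i \<Longrightarrow> x - y \<in> V i"
  "x \<in> V i \<Longrightarrow> c *s x \<in> V i"
  using subspace_component subspace_add subspace_diff subspace_scale by blast+

text \<open>Replaces the definite description in \<open>hcomp\<close> by an actual splitting:
  existence comes from \<open>component_sum\<close>, uniqueness from
  \<open>hcomp_eqI\<close>.\<close>

lemma hcomp_decomposition:
  obtains z where "hcomp V i x \<in> V i" "z \<in> V (i + 1)" "x = hcomp V i x + z"
proof -
  obtain y z where *: "y \<in> V 0" "z \<in> V 1" "x = y + z" using component_sum by blast
  show thesis
  proof (cases i)
    case zero
    then have "hcomp V i x = y" using hcomp_eqI[of y i z] * by simp
    then show ?thesis using that * zero by simp
  next
    case one
    then have "hcomp V i x = z" using hcomp_eqI[of z i y] * by (simp add: add.commute)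
    then show ?thesis using that * one by (simp add: add.commute)
  qed
qed

text \<open>Adding the splittings of \<open>x\<close> and \<open>y\<close> gives a splitting of
  \<open>x + y\<close>, and splittings are unique.\<close>

lemma hcomp_add: "hcomp V i (x + y) = hcomp V i x + hcomp V i y"
proof -
  obtain a where a: "hcomp V i x \<in> V i" "a \<in> V (i + 1)" "x = hcomp V i x + a"
    by (rule hcomp_decomposition)
  obtain b where b: "hcomp V i y \<in> V i" "b \<in> V (i + 1)" "y = hcomp V i y + b"
    by (rule hcomp_decomposition)
  have "x + y = (hcomp V i x + hcomp V i y) + (a + b)"
    using a(3) b(3) by (metis add.assoc add.left_commute)
  then show ?thesis using hcomp_eqI a b subspace_simps(1) by metis
qed

lemma hcomp_scale: "hcomp V i (c *s x) = c *s hcomp V i x"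
proof -
  obtain a where a: "hcomp V i x \<in> V i" "a \<in> V (i + 1)" "x = hcomp V i x + a"
    by (rule hcomp_decomposition)
  have "c *s x = c *s hcomp V i x + c *s a"
    using a(3) scale_right_distrib by metis
  then show ?thesis using hcomp_eqI a subspace_simps(3) by metis
qed

end

section \<open>The product and its signed commutators\<close>

context right_hom_alternative_superalgebra
begin

lemma mul_linear_left: "Vector_Spaces.linear scale scale (\<lambda>x. x \<star> y)"
  and mul_linear_right: "Vector_Spaces.linear scale scale (\<lambda>y. x \<star> y)"
  using bilinear by (auto simp: bilinear_op_def)

lemmas hom_left = mul_linear_left[THEN Vector_Spaces.linear.axioms(3)]
lemmas hom_right = mul_linear_right[THEN Vector_Spaces.linear.axioms(3)]

lemmas mul_simps =
  module_hom.add[OF hom_left] module_hom.add[OF hom_right]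
  module_hom.diff[OF hom_left] module_hom.diff[OF hom_right]
  module_hom.neg[OF hom_left] module_hom.neg[OF hom_right]
  module_hom.zero[OF hom_left] module_hom.zero[OF hom_right]
  module_hom.scale[OF hom_left] module_hom.scale[OF hom_right]

lemmas \<alpha>_simps = add diff neg zero scale multiplicative

lemmas scale_simps = scale_right_distrib scale_right_diff_distrib scale_minus_right

text \<open>The operations below take the degrees of their arguments as parameters, which determine the
  signs; this makes them multilinear on all of the algebra.\<close>

definition jordan :: "bit \<Rightarrow> bit \<Rightarrow> 'a \<Rightarrow> 'a \<Rightarrow> 'a" where
  "jordan i j x y = x \<star> y + ksign (i * j) *s (y \<star> x)"

definition bracket :: "bit \<Rightarrow> bit \<Rightarrow> 'a \<Rightarrow> 'a \<Rightarrow> 'a" where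
  "bracket i j x y = x \<star> y - ksign (i * j) *s (y \<star> x)"

text \<open>The supercommutator of the twisted right multiplications R_x and R_y, with operators
  acting from the right: in the leading term \<open>x\<close> acts first. No sign involves
  \<open>z\<close>, which already stands leftmost.\<close>

definition rcomm :: "bit \<Rightarrow> bit \<Rightarrow> 'a \<Rightarrow> 'a \<Rightarrow> 'a \<Rightarrow> 'a" where
  "rcomm i j x y z = (z \<star> x) \<star> \<alpha> y - ksign (i * j) *s ((z \<star> y) \<star> \<alpha> x)"

text \<open>The sign in front of \<open>rcomm\<close> is the cost of moving \<open>z\<close> past
  \<open>x\<close> and \<open>y\<close>.\<close>

definition triple :: "bit \<Rightarrow> bit \<Rightarrow> bit \<Rightarrow> 'a \<Rightarrow> 'a \<Rightarrow> 'a \<Rightarrow> 'a" where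
  "triple i j k x y z = bracket i j x y \<star> \<alpha> z - ksign (k * (i + j)) *s rcomm i j x y z"

text \<open>Having the degree equation as a premise lets the rule match degree sums written in
  another order.\<close>

lemma graded_eq: "x \<in> V i \<Longrightarrow> y \<in> V j \<Longrightarrow> k = i + j \<Longrightarrow> x \<star> y \<in> V k"
  using graded by blast

lemma jordan_mem: "x \<in> V i \<Longrightarrow> y \<in> V j \<Longrightarrow> jordan i j x y \<in> V (i + j)"
  unfolding jordan_def
  by (auto intro!: subspace_simps intro: graded_eq simp: add.commute)

lemma bracket_mem: "x \<in> V i \<Longrightarrow> y \<in> V j \<Longrightarrow> bracket i j x y \<in> V (i + j)"
  unfolding bracket_def by (auto intro!: subspace_simps intro: graded_eq simp: add.commute)

lemma rcomm_mem: "x \<in> V i \<Longrightarrow> y \<in> V j \<Longrightarrow> z \<in> V k \<Longrightarrow> rcomm i j x y z \<in> V (i + j + k)"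
  unfolding rcomm_def by (intro subspace_simps graded_eq even) (auto simp: algebra_simps)

lemma triple_mem: "x \<in> V i \<Longrightarrow> y \<in> V j \<Longrightarrow> z \<in> V k \<Longrightarrow> triple i j k x y z \<in> V (i + j + k)"
  unfolding triple_def by (intro subspace_simps graded_eq[OF bracket_mem] rcomm_mem even) auto

section \<open>Commutators of right multiplications\<close>

lemma mul_jordan:
  assumes "t \<in> V h" "x \<in> V i" "y \<in> V j"
  shows "\<alpha> t \<star> jordan i j x y = (t \<star> x) \<star> \<alpha> y + ksign (i * j) *s ((t \<star> y) \<star> \<alpha> x)"
  \<comment> \<open>This is the skew-symmetry of the Hom-associator, with the products that have
    \<open>\<alpha> t\<close> in front collected on one side.\<close>
  using right_alternative[OF assms]
  by (simp add: hom_associator_def jordan_def mul_simps scale_simps algebra_simps)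

text \<open>In each outer Jordan product, \<open>mul_jordan\<close> expands the half with
  \<open>\<alpha> x\<close> or \<open>\<alpha> y\<close> on the left. The words (xz)y and (yz)x then
  cancel; [x,y]z and the commutator term remain.\<close>

lemma triple_eq_jordan:
  assumes "x \<in> V i" "y \<in> V j" "z \<in> V k"
  shows "triple i j k x y z = jordan i (j + k) (\<alpha> x) (jordan j k y z)
    - ksign (i * j) *s jordan j (i + k) (\<alpha> y) (jordan i k x z)"
proof -
  have 1: "jordan i (j + k) (\<alpha> x) (jordan j k y z) =
      (x \<star> y) \<star> \<alpha> z + ksign (j * k) *s ((x \<star> z) \<star> \<alpha> y)
      + ksign (i * (j + k)) *s (jordan j k y z \<star> \<alpha> x)"
    "jordan j (i + k) (\<alpha> y) (jordan i k x z) =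
      (y \<star> x) \<star> \<alpha> z + ksign (i * k) *s ((y \<star> z) \<star> \<alpha> x)
      + ksign (j * (i + k)) *s (jordan i k x z \<star> \<alpha> y)"
    unfolding jordan_def[of i "j + k"] jordan_def[of j "i + k"]
      mul_jordan[OF assms] mul_jordan[OF assms(2,1,3)] by simp_all
  show ?thesis
    unfolding 1 triple_def bracket_def rcomm_def
    unfolding jordan_def
    by (cases i; cases j; cases k) (simp_all add: mul_simps algebra_simps)
qed

text \<open>The operator rule is used for the outer Jordan product and then for the inner one, once
  behind \<open>t \<star> x\<close> and once behind \<open>t\<close>. Multiplicativity of
  \<open>\<alpha>\<close> gives the factors the required form.\<close>

lemma mul_jordan_jordan:
  assumes t: "t \<in> V h" and x: "x \<in> V i" and y: "y \<in> V j" and z: "z \<in> V k"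
  shows "\<alpha> (\<alpha> t) \<star> jordan i (j + k) (\<alpha> x) (jordan j k y z) =
    ((t \<star> x) \<star> \<alpha> y) \<star> \<alpha> (\<alpha> z) + ksign (j * k) *s (((t \<star> x) \<star> \<alpha> z) \<star> \<alpha> (\<alpha> y))
    + ksign (i * (j + k)) *s
      (((t \<star> y) \<star> \<alpha> z + ksign (j * k) *s ((t \<star> z) \<star> \<alpha> y)) \<star> \<alpha> (\<alpha> x))"
proof -
  have "\<alpha> (jordan j k y z) = jordan j k (\<alpha> y) (\<alpha> z)"
    by (simp add: jordan_def \<alpha>_simps)
  then show ?thesis
    using mul_jordan[OF even[OF t] even[OF x] jordan_mem[OF y z]] mul_jordan[OF t y z]
      mul_jordan[OF graded[OF t x] even[OF y] even[OF z]]
    by (simp add: multiplicative)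
qed

text \<open>The rule \<open>D(tz) = D(t) z - t T(z)\<close>.\<close>

lemma rcomm_mul:
  assumes t: "t \<in> V h" and x: "x \<in> V i" and y: "y \<in> V j" and z: "z \<in> V k"
  shows "rcomm i j (\<alpha> x) (\<alpha> y) (t \<star> z) = ksign (k * (i + j)) *s
    (rcomm i j x y t \<star> \<alpha> (\<alpha> z) - \<alpha> (\<alpha> t) \<star> triple i j k x y z)"
  \<comment> \<open>Every summand is now \<open>t\<close> multiplied from the right by
    \<open>x\<close>, \<open>y\<close>, \<open>z\<close> in some order; the orders with
    \<open>z\<close> in the middle cancel.\<close>
  unfolding triple_eq_jordan[OF x y z] rcomm_def mul_simps
    mul_jordan_jordan[OF t x y z] mul_jordan_jordan[OF t y x z]
  by (cases i; cases j; cases k) (simp_all add: mul_simps algebra_simps)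

section \<open>Symmetries and compatibility with \<open>\<alpha>\<close>\<close>

lemma bracket_skew: "bracket i j x y = - (ksign (i * j) *s bracket j i y x)"
  unfolding bracket_def by (cases i; cases j) simp_all

lemma triple_skew: "triple i j k x y z = - (ksign (i * j) *s triple j i k y x z)"
  unfolding triple_def bracket_def rcomm_def
  by (cases i; cases j; cases k) (simp_all add: mul_simps algebra_simps)

text \<open>After expansion each of the six words such as (xy)z occurs twice, with opposite
  signs.\<close>

lemma triple_cyclic:
  "triple i j k x y z + ksign (i * (j + k)) *s triple j k i y z x
    + ksign (k * (i + j)) *s triple k i j z x y = 0"
  unfolding triple_def bracket_def rcomm_def
  by (cases i; cases j; cases k) (simp_all add: mul_simps algebra_simps)

lemma \<alpha>_bracket: "\<alpha> (bracket i j x y) = bracket i j (\<alpha> x) (\<alpha> y)"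
  by (simp add: bracket_def \<alpha>_simps)

lemma \<alpha>_triple: "\<alpha> (triple i j k x y z) = triple i j k (\<alpha> x) (\<alpha> y) (\<alpha> z)"
  by (simp add: triple_def rcomm_def \<alpha>_bracket \<alpha>_simps)

section \<open>The identities (SHB4) and (SHB5) on homogeneous elements\<close>

lemma rcomm_simps:
  "rcomm i j x y (a + b) = rcomm i j x y a + rcomm i j x y b"
  "rcomm i j x y (a - b) = rcomm i j x y a - rcomm i j x y b"
  "rcomm i j x y (- a) = - rcomm i j x y a"
  "rcomm i j x y (c *s a) = c *s rcomm i j x y a"
  by (simp_all add: rcomm_def mul_simps scale_simps scale_left_commute)

text \<open>Measures how far T = {x,y,_} is from a derivation of the bracket. Up to signs,
  \<open>rcomm_mul\<close> splits D([u,v]) into D(u)v - uT(v) and D(v)u - vT(u). The terms D(u)v and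
  D(v)u cancel against those in T(u)v and T(v)u, since T(u) = [x,y]u - D(u).\<close>

lemma bracket_triple:
  assumes x: "x \<in> V i" and y: "y \<in> V j" and u: "u \<in> V k" and v: "v \<in> V l"
  shows "bracket (i + j + k) l (triple i j k x y u) (\<alpha> (\<alpha> v))
    + ksign (k * (i + j)) *s bracket k (i + j + l) (\<alpha> (\<alpha> u)) (triple i j l x y v)
    = rcomm k l (\<alpha> u) (\<alpha> v) (bracket i j x y)
      - ksign ((i + j) * (k + l)) *s rcomm i j (\<alpha> x) (\<alpha> y) (bracket k l u v)"
  unfolding bracket_def[of _ l] bracket_def[of k] rcomm_simps
    rcomm_mul[OF u x y v] rcomm_mul[OF v x y u]
  by (cases i; cases j; cases k; cases l)
    (simp_all add: triple_def rcomm_def[of _ _ "\<alpha> u"] mul_simps algebra_simps)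

text \<open>The \<open>rcomm\<close> terms agree by \<open>bracket_triple\<close>. Up to signs, the
  product [u,v][x,y] minus the double bracket [[u,v],[x,y]] leaves [x,y][u,v], the product part of
  the left side.\<close>

lemma triple_bracket:
  assumes x: "x \<in> V i" and y: "y \<in> V j" and u: "u \<in> V k" and v: "v \<in> V l"
  shows "triple i j (k + l) (\<alpha> x) (\<alpha> y) (bracket k l u v) =
    bracket (i + j + k) l (triple i j k x y u) (\<alpha> (\<alpha> v))
    + ksign (k * (i + j)) *s bracket k (i + j + l) (\<alpha> (\<alpha> u)) (triple i j l x y v)
    + ksign ((i + j) * (k + l)) *s
        (triple k l (i + j) (\<alpha> u) (\<alpha> v) (bracket i j x y)
          - bracket (k + l) (i + j) (bracket k l (\<alpha> u) (\<alpha> v)) (bracket i j (\<alpha> x) (\<alpha> y)))"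
  unfolding bracket_triple[OF assms]
  unfolding triple_def \<alpha>_bracket bracket_def[of "_ + _"]
  by (cases i; cases j; cases k; cases l) (simp_all add: mul_simps algebra_simps)

text \<open>As operators, R_{T(u)} = [D, R_u], so this is the Jacobi identity for D, R_u and
  R_v.\<close>

lemma rcomm_triple:
  assumes x: "x \<in> V i" and y: "y \<in> V j" and u: "u \<in> V k" and v: "v \<in> V l" and z: "z \<in> V m"
  shows "rcomm (i + j + k) l (triple i j k x y u) (\<alpha> (\<alpha> v)) (\<alpha> (\<alpha> z))
    + ksign (k * (i + j)) *s rcomm k (i + j + l) (\<alpha> (\<alpha> u)) (triple i j l x y v) (\<alpha> (\<alpha> z))
    = rcomm k l (\<alpha> (\<alpha> u)) (\<alpha> (\<alpha> v)) (rcomm i j x y z)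
      - ksign ((i + j) * (k + l)) *s rcomm i j (\<alpha> (\<alpha> x)) (\<alpha> (\<alpha> y)) (rcomm k l u v z)"
proof -
  have 1: "\<alpha> (\<alpha> z) \<star> triple i j p x y a = rcomm i j x y z \<star> \<alpha> (\<alpha> a)
      - ksign (p * (i + j)) *s rcomm i j (\<alpha> x) (\<alpha> y) (z \<star> a)"
    if "a \<in> V p" for a p
    using rcomm_mul[OF z x y that] by (cases i; cases j; cases p) simp_all
  \<comment> \<open>Fact \<open>1\<close> covers the triple product acting first, this one the
    triple product acting second, behind \<open>z \<star> b\<close>.\<close>
  have 2: "(\<alpha> (\<alpha> z) \<star> \<alpha> (\<alpha> b)) \<star> \<alpha> (triple i j p x y a)
      = rcomm i j (\<alpha> x) (\<alpha> y) (z \<star> b) \<star> \<alpha> (\<alpha> (\<alpha> a))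
      - ksign (p * (i + j)) *s rcomm i j (\<alpha> (\<alpha> x)) (\<alpha> (\<alpha> y)) ((z \<star> b) \<star> \<alpha> a)"
    if "a \<in> V p" "b \<in> V q" for a p b q
    using rcomm_mul[OF graded[OF z that(2)] even[OF x] even[OF y] even[OF that(1)]]
    by (cases i; cases j; cases p) (simp_all add: multiplicative \<alpha>_triple)
  show ?thesis
    unfolding rcomm_def[of k l] rcomm_def[of "_ + _"] rcomm_def[of k "_ + _"]
      1[OF u] 1[OF v] 2[OF u v] 2[OF v u] rcomm_simps
    by (cases i; cases j; cases k; cases l) (simp_all add: mul_simps algebra_simps)
qed

text \<open>A triple product {u,v,z} consists of [u,v]z and [R_u,R_v](z). The effect of T on
  \<open>u\<close> and \<open>v\<close> is given by \<open>bracket_triple\<close> for the first part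
  and by \<open>rcomm_triple\<close> for the second.\<close>

lemma triple_derivation:
  assumes x: "x \<in> V i" and y: "y \<in> V j" and u: "u \<in> V k" and v: "v \<in> V l" and z: "z \<in> V m"
  shows "triple i j (k + l + m) (\<alpha> (\<alpha> x)) (\<alpha> (\<alpha> y)) (triple k l m u v z) =
    triple (i + j + k) l m (triple i j k x y u) (\<alpha> (\<alpha> v)) (\<alpha> (\<alpha> z))
    + ksign (k * (i + j)) *s triple k (i + j + l) m (\<alpha> (\<alpha> u)) (triple i j l x y v) (\<alpha> (\<alpha> z))
    + ksign ((i + j) * (k + l)) *s triple k l (i + j + m) (\<alpha> (\<alpha> u)) (\<alpha> (\<alpha> v)) (triple i j m x y z)"
proof -
  let ?w = "bracket i j x y" and ?c = "bracket k l u v"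
  have 1: "triple (i + j + k) l m (triple i j k x y u) (\<alpha> (\<alpha> v)) (\<alpha> (\<alpha> z))
    + ksign (k * (i + j)) *s triple k (i + j + l) m (\<alpha> (\<alpha> u)) (triple i j l x y v) (\<alpha> (\<alpha> z))
    = (rcomm k l (\<alpha> u) (\<alpha> v) ?w - ksign ((i + j) * (k + l)) *s rcomm i j (\<alpha> x) (\<alpha> y) ?c)
      \<star> \<alpha> (\<alpha> (\<alpha> z))
    - ksign (m * (i + j + k + l)) *s
      (rcomm k l (\<alpha> (\<alpha> u)) (\<alpha> (\<alpha> v)) (rcomm i j x y z)
      - ksign ((i + j) * (k + l)) *s rcomm i j (\<alpha> (\<alpha> x)) (\<alpha> (\<alpha> y)) (rcomm k l u v z))"
    unfolding bracket_triple[OF x y u v, symmetric] rcomm_triple[OF assms, symmetric]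
    unfolding triple_def[of "_ + _"] triple_def[of k "_ + _"]
    by (cases i; cases j; cases k; cases l; cases m) (simp_all add: mul_simps algebra_simps)
  \<comment> \<open>The nested triple products contain [R_x,R_y]([u,v]z) and [R_u,R_v]([x,y]z); the
    operator rule splits both.\<close>
  note 2 = rcomm_mul[OF bracket_mem[OF u v] even[OF x] even[OF y] even[OF z]]
  note 3 = rcomm_mul[OF bracket_mem[OF x y] even[OF u] even[OF v] even[OF z]]
  have 4: "\<alpha> (triple p q m a b z) = triple p q m (\<alpha> a) (\<alpha> b) (\<alpha> z)" for p q a b
    by (rule \<alpha>_triple)
  show ?thesis
    unfolding 1
    unfolding triple_def[of i j "_ + _"] triple_def[of k l "_ + _"] 4
    \<comment> \<open>Triple products starting with \<open>\<alpha> x\<close> or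
      \<open>\<alpha> u\<close> stay folded, because \<open>2\<close> and \<open>3\<close> produce
      the same ones and they cancel.\<close>
    unfolding triple_def[of i j m x] triple_def[of k l m u] rcomm_simps 2 3
    unfolding \<alpha>_bracket[symmetric]
    by (cases i; cases j; cases k; cases l; cases m) (simp_all add: mul_simps algebra_simps)
qed

section \<open>Multilinear extension to the whole algebra\<close>

lemma bracket_scale:
  "bracket i j (c *s x) y = c *s bracket i j x y"
  "bracket i j x (c *s y) = c *s bracket i j x y"
  by (simp_all add: bracket_def mul_simps scale_simps scale_left_commute)

lemma triple_add:
  "triple i j k (x + x') y z = triple i j k x y z + triple i j k x' y z"
  "triple i j k x (y + y') z = triple i j k x y z + triple i j k x y' z"
  "triple i j k x y (z + z') = triple i j k x y z + triple i j k x y z'"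
  by (simp_all add: triple_def bracket_def rcomm_def mul_simps \<alpha>_simps scale_simps)

lemma triple_scale:
  "triple i j k (c *s x) y z = c *s triple i j k x y z"
  "triple i j k x (c *s y) z = c *s triple i j k x y z"
  "triple i j k x y (c *s z) = c *s triple i j k x y z"
  by (simp_all add: triple_def bracket_def rcomm_def mul_simps \<alpha>_simps scale_simps
      scale_left_commute del: scale_scale)

lemma triple_zero: "triple i j k 0 y z = 0" "triple i j k x 0 z = 0" "triple i j k x y 0 = 0"
  by (simp_all add: triple_def bracket_def rcomm_def mul_simps \<alpha>_simps)

text \<open>Since \<open>triple\<close> depends on the degrees of its arguments, it is extended to
  arbitrary vectors through their components.\<close>

definition bol :: "'a \<Rightarrow> 'a \<Rightarrow> 'a \<Rightarrow> 'a" where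
  "bol x y z = (\<Sum>i\<in>{0, 1}. \<Sum>j\<in>{0, 1}. \<Sum>k\<in>{0, 1}.
     (1 / 4) *s triple i j k (hcomp V i x) (hcomp V j y) (hcomp V k z))"

lemma bol_homogeneous:
  assumes "x \<in> V i" "y \<in> V j" "z \<in> V k"
  shows "bol x y z = (1 / 4) *s triple i j k x y z"
  using assms by (cases i; cases j; cases k) (simp_all add: bol_def hcomp_homogeneous triple_zero)

lemma supercommutator_bracket:
  "x \<in> V i \<Longrightarrow> y \<in> V j \<Longrightarrow> supercommutator scale V (\<star>) x y = (1 / 2) *s bracket i j x y"
  by (simp add: supercommutator_homogeneous bracket_def)

lemma bilinear_supercommutator: "bilinear_op scale (supercommutator scale V (\<star>))"
  unfolding bilinear_op_def supercommutator_def
  by (intro conjI allI linearI)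
    (simp_all add: hcomp_add hcomp_scale mul_simps scale_simps scale_left_commute del: scale_scale)

lemma trilinear_bol: "trilinear_op scale bol"
  unfolding trilinear_op_def bol_def
  by (intro conjI allI linearI)
    (simp_all add: hcomp_add hcomp_scale triple_add triple_scale scale_simps scale_left_commute
      del: scale_scale)

section \<open>Verification of the Hom-Bol axioms\<close>

lemma hom_bol: "hom_bol_superalgebra scale V (supercommutator scale V (\<star>)) bol \<alpha>"
proof -
  note sc = supercommutator_bracket and bh = bol_homogeneous
    and mem = subspace_simps(3)[OF bracket_mem] subspace_simps(3)[OF triple_mem]
  show ?thesis
  proof unfold_locales
    show "bilinear_op scale (supercommutator scale V (\<star>))" by (rule bilinear_supercommutator)
    show "trilinear_op scale bol" by (rule trilinear_bol)
    fix x y i j assume x: "x \<in> V i" and y: "y \<in> V j"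
    show "supercommutator scale V (\<star>) x y \<in> V (i + j)"
      using mem(1)[OF x y] by (simp add: sc[OF x y])
    show "\<alpha> (supercommutator scale V (\<star>) x y) = supercommutator scale V (\<star>) (\<alpha> x) (\<alpha> y)"
      by (simp add: sc[OF x y] sc[OF even[OF x] even[OF y]] scale \<alpha>_bracket)
    show "supercommutator scale V (\<star>) x y = - (ksign (i * j) *s supercommutator scale V (\<star>) y x)"
      unfolding sc[OF x y] sc[OF y x] bracket_skew[of i j x y]
      by (simp add: scale_left_commute scale_minus_right del: scale_scale)
    fix z k assume z: "z \<in> V k"
    show "bol x y z \<in> V (i + j + k)"
      using mem(2)[OF x y z] by (simp add: bh[OF x y z])
    show "\<alpha> (bol x y z) = bol (\<alpha> x) (\<alpha> y) (\<alpha> z)"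
      by (simp add: bh[OF x y z] bh[OF even[OF x] even[OF y] even[OF z]] scale \<alpha>_triple)
    show "bol x y z = - (ksign (i * j) *s bol y x z)"
      unfolding bh[OF x y z] bh[OF y x z] triple_skew[of i j k x y z]
      by (simp add: scale_left_commute scale_minus_right del: scale_scale)
    show "bol x y z + ksign (i * (j + k)) *s bol y z x + ksign (k * (i + j)) *s bol z x y = 0"
      unfolding bh[OF x y z] bh[OF y z x] bh[OF z x y] scale_left_commute[of _ "1 / 4"]
        scale_right_distrib[symmetric] triple_cyclic by simp
  next
    fix x y u v i j k l
    assume x: "x \<in> V i" and y: "y \<in> V j" and u: "u \<in> V k" and v: "v \<in> V l"
    show "bol (\<alpha> x) (\<alpha> y) (supercommutator scale V (\<star>) u v) =
      supercommutator scale V (\<star>) (bol x y u) ((\<alpha> ^^ 2) v)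
      + ksign (k * (i + j)) *s supercommutator scale V (\<star>) ((\<alpha> ^^ 2) u) (bol x y v)
      + ksign ((i + j) * (k + l)) *s
          (bol (\<alpha> u) (\<alpha> v) (supercommutator scale V (\<star>) x y)
           - supercommutator scale V (\<star>) (supercommutator scale V (\<star>) (\<alpha> u) (\<alpha> v))
               (supercommutator scale V (\<star>) (\<alpha> x) (\<alpha> y)))"
      \<comment> \<open>Every term carries the factor 1/8: 1/4 times 1/2 for a triple product with a
        bracket, and the cube of 1/2 for the double bracket.\<close>
      using triple_bracket[OF x y u v]
      by (simp add: bh[OF x y u] bh[OF x y v] sc[OF x y] sc[OF u v] sc[OF even[OF x] even[OF y]]
          sc[OF even[OF u] even[OF v]] bh[OF even[OF x] even[OF y] mem(1)[OF u v]]
          bh[OF even[OF u] even[OF v] mem(1)[OF x y]] sc[OF mem(2)[OF x y u] even[OF even[OF v]]]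
          sc[OF even[OF even[OF u]] mem(2)[OF x y v]]
          sc[OF mem(1)[OF even[OF u] even[OF v]] mem(1)[OF even[OF x] even[OF y]]]
          numeral_2_eq_2 triple_scale bracket_scale scale_simps mult.commute)
  next
    fix x y u v w i j k l m
    assume x: "x \<in> V i" and y: "y \<in> V j" and u: "u \<in> V k" and v: "v \<in> V l" and w: "w \<in> V m"
    show "bol ((\<alpha> ^^ 2) x) ((\<alpha> ^^ 2) y) (bol u v w) =
      bol (bol x y u) ((\<alpha> ^^ 2) v) ((\<alpha> ^^ 2) w)
      + ksign (k * (i + j)) *s bol ((\<alpha> ^^ 2) u) (bol x y v) ((\<alpha> ^^ 2) w)
      + ksign ((i + j) * (k + l)) *s bol ((\<alpha> ^^ 2) u) ((\<alpha> ^^ 2) v) (bol x y w)"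
      \<comment> \<open>Every term is a nested triple product and carries the factor 1/16.\<close>
      using triple_derivation[OF x y u v w]
      by (simp add: bh[OF u v w] bh[OF x y u] bh[OF x y v] bh[OF x y w]
          bh[OF even[OF even[OF x]] even[OF even[OF y]] mem(2)[OF u v w]]
          bh[OF mem(2)[OF x y u] even[OF even[OF v]] even[OF even[OF w]]]
          bh[OF even[OF even[OF u]] mem(2)[OF x y v] even[OF even[OF w]]]
          bh[OF even[OF even[OF u]] even[OF even[OF v]] mem(2)[OF x y w]]
          numeral_2_eq_2 triple_scale scale_simps mult.commute)
  qed
qed

end

theorem theorem7p3:
  fixes scale :: "'k::field \<Rightarrow> 'a::ab_group_add \<Rightarrow> 'a"
    and V :: "bit \<Rightarrow> 'a set"
    and mul :: "'a \<Rightarrow> 'a \<Rightarrow> 'a"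
    and \<alpha> :: "'a \<Rightarrow> 'a"
  assumes "CHAR('k) \<noteq> 2" and "CHAR('k) \<noteq> 3"
    and "right_hom_alternative_superalgebra scale V mul \<alpha>"
  shows "\<exists>tri. hom_bol_superalgebra scale V (supercommutator scale V mul) tri \<alpha>"
  using right_hom_alternative_superalgebra.hom_bol[OF assms(3)] by blast

end
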